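(* Denote $Z(t)=(Q(t),p(t))^\top\in\mathbb{R}^{2N}$, $t\in[0,\infty)$. The dynamics of the periodic agent system $$dQ_n(t)=\bigl(p_{n+1}(t)-p_n(t)\bigr)\,dt,\qquad Q(0)=Q_0,$$ $$dp_n(t)=\bigl(U'(Q_n(t))-U'(Q_{n-1}(t))\bigr)\,dt+\beta\bigl(p_{n+1}(t)-2p_n(t)+p_{n-1}(t)\bigr)\,dt+\sigma\,dW_n(t),\qquad p(0)=p_0,$$ $n\in\{1,\dots,N\}$ (indices taken cyclically modulo $N$), are given by $$dZ(t)=(J-R)\nabla H(Z(t))\,dt+G\,dW(t),\qquad Z(0)=z_0=(Q_0,p_0)^\top,$$ with $$J=\begin{bmatrix}0&A\\-A^\top&0\end{bmatrix}\in\mathbb{R}^{2N\times 2N},\quad R=\begin{bmatrix}0&0\\0&\beta A^\top A\end{bmatrix}\in\mathbb{R}^{2N\times 2N},\quad G=\begin{bmatrix}0\\ \sigma I\end{bmatrix}\in\mathbb{R}^{2N\times N},$$ and the Hamiltonian $H\colon\mathbb{R}^{2N}\to\mathbb{R}$, $$H(Q,p)=\frac12\|p\|^2+\sum_{n=1}^N U(Q_n),\qquad p\in\mathbb{R}^N,\ Q=(Q_1,\dots,Q_N)^\top\in\mathbb{R}^N.$$ Moreover, the matrix $J$ is skew-symmetric and the matrix $R$ is symmetric positive semi-definite.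
   Context: $N\ge 3$ is an integer, $\beta\in(0,\infty)$, $\sigma\in\mathbb{R}$, $U\in C^1(\mathbb{R},[0,\infty))$ is convex with derivative $U'$, and $W=(W_n)_{n=1}^N$ is an $N$-dimensional standard Brownian motion. $Q_0\in[0,\infty)^N$ and $p_0\in\mathbb{R}^N$ are given initial data, with $\sum_{n=1}^N (Q_0)_n=L>0$. $Q(t)=(Q_n(t))_{n=1}^N$ (distances) and $p(t)=(p_n(t))_{n=1}^N$ (velocities) denote a solution of the system. Indices are cyclic: $n+1$ means $1$ if $n=N$, and $n-1$ means $N$ if $n=1$. $I$ is the $N\times N$ identity matrix. The matrix $A\in\mathbb{R}^{N\times N}$ is the circulant matrix with $A_{n,n}=-1$ for all $n$, $A_{n,n+1}=1$ for $n\in\{1,\dots,N-1\}$, $A_{N,1}=1$, and all other entries $0$. $\|\cdot\|$ is the Euclidean norm. *)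

theory Defs
  imports "HOL-Probability.Probability" "Berlekamp_Zassenhaus.Finite_Field"
begin

(* Coordinates are indexed by the cyclic type 'n mod_ring (integers modulo N = CARD('n)), so that
   R^N is real ^ 'n mod_ring and the index shifts n + 1, n - 1 wrap around; the index N of
   {1, ..., N} is represented by 0. R^(2N) is real ^ ('n mod_ring + 'n mod_ring), with Inl indexing
   the first N coordinates and Inr the last N. *)

(* A matrix is a vector of rows, so stack applied to two matrices puts the first above the second. *)
definition stack :: "'b ^ 'k \<Rightarrow> 'b ^ 'l \<Rightarrow> 'b ^ ('k::finite + 'l::finite)" where
  "stack x y = (\<chi> i. case i of Inl k \<Rightarrow> x $ k | Inr l \<Rightarrow> y $ l)"

definition block_matrix ::
  "'b ^ 'k ^ 'r \<Rightarrow> 'b ^ 'l ^ 'r \<Rightarrow> 'b ^ 'k ^ 's \<Rightarrow> 'b ^ 'l ^ 's \<Rightarrow>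
    'b ^ ('k::finite + 'l::finite) ^ ('r::finite + 's::finite)" where
  "block_matrix B C D E = stack (\<chi> i. stack (B $ i) (C $ i)) (\<chi> i. stack (D $ i) (E $ i))"

definition circ_mat :: "real ^ 'n mod_ring ^ 'n::nontriv mod_ring" where
  "circ_mat = (\<chi> i j. if j = i then - 1 else if j = i + 1 then 1 else 0)"

definition J_mat ::
  "real ^ ('n mod_ring + 'n mod_ring) ^ ('n::nontriv mod_ring + 'n mod_ring)" where
  "J_mat = block_matrix 0 circ_mat (- transpose circ_mat) 0"

definition R_mat ::
  "real \<Rightarrow> real ^ ('n mod_ring + 'n mod_ring) ^ ('n::nontriv mod_ring + 'n mod_ring)" where
  "R_mat \<beta> = block_matrix 0 0 0 (\<beta> *\<^sub>R (transpose circ_mat ** circ_mat))"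

definition G_mat ::
  "real \<Rightarrow> real ^ 'n mod_ring ^ ('n::nontriv mod_ring + 'n mod_ring)" where
  "G_mat \<sigma> = stack 0 (\<sigma> *\<^sub>R mat 1)"

definition hamiltonian ::
  "(real \<Rightarrow> real) \<Rightarrow> real ^ ('n mod_ring + 'n::nontriv mod_ring) \<Rightarrow> real" where
  "hamiltonian U z = 1 / 2 * (norm (\<chi> n. z $ Inr n))\<^sup>2 + (\<Sum>n\<in>UNIV. U (z $ Inl n))"

definition grad :: "('v::real_inner \<Rightarrow> real) \<Rightarrow> 'v \<Rightarrow> 'v" where
  "grad f x = (THE d. GDERIV f x :> d)"

definition filtered_prob_space :: "'a measure \<Rightarrow> (real \<Rightarrow> 'a measure) \<Rightarrow> bool" where
  "filtered_prob_space M F \<longleftrightarrow>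
     prob_space M \<and> filtration (space M) F \<and> (\<forall>t. subalgebra M (F t))"

definition adapted_continuous ::
  "'a measure \<Rightarrow> (real \<Rightarrow> 'a measure) \<Rightarrow> (real \<Rightarrow> 'a \<Rightarrow> 'v::euclidean_space) \<Rightarrow> bool" where
  "adapted_continuous M F X \<longleftrightarrow>
     (\<forall>t\<ge>0. X t \<in> borel_measurable (F t)) \<and>
     (AE \<omega> in M. continuous_on {0..} (\<lambda>t. X t \<omega>))"

definition standard_brownian_motion ::
  "'a measure \<Rightarrow> (real \<Rightarrow> 'a measure) \<Rightarrow> (real \<Rightarrow> 'a \<Rightarrow> real ^ 'm::finite) \<Rightarrow> bool" where
  "standard_brownian_motion M F W \<longleftrightarrow>
     adapted_continuous M F W \<and> (AE \<omega> in M. W 0 \<omega> = 0) \<and>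
     (\<forall>s t. 0 \<le> s \<and> s < t \<longrightarrow>
        prob_space.indep_set M (sets (F s))
          (sets (vimage_algebra (space M) (\<lambda>\<omega>. W t \<omega> - W s \<omega>) borel)) \<and>
        prob_space.indep_vars M (\<lambda>_. borel) (\<lambda>i \<omega>. (W t \<omega> - W s \<omega>) $ i) UNIV \<and>
        (\<forall>i. distributed M lborel (\<lambda>\<omega>. (W t \<omega> - W s \<omega>) $ i)
               (\<lambda>x. ennreal (normal_density 0 (sqrt (t - s)) x))))"

(* dX(t) = b(t) dt + g dW(t), X(0) = x0, in integrated form. The noise coefficient g is a constant
   linear map, so its stochastic integral over [0, t] is g (W t - W 0). *)
definition ito_differential ::
  "'a measure \<Rightarrow> (real \<Rightarrow> 'a \<Rightarrow> 'w::euclidean_space) \<Rightarrow> (real \<Rightarrow> 'a \<Rightarrow> 'v::euclidean_space) \<Rightarrow> 'v \<Rightarrow>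
    (real \<Rightarrow> 'a \<Rightarrow> 'v) \<Rightarrow> ('w \<Rightarrow> 'v) \<Rightarrow> bool" where
  "ito_differential M W X x0 b g \<longleftrightarrow>
     (AE \<omega> in M. \<forall>t\<ge>0. (\<lambda>s. b s \<omega>) absolutely_integrable_on {0..t} \<and>
        X t \<omega> = x0 + integral {0..t} (\<lambda>s. b s \<omega>) + g (W t \<omega> - W 0 \<omega>))"

definition agent_solution ::
  "'a measure \<Rightarrow> (real \<Rightarrow> 'a measure) \<Rightarrow> (real \<Rightarrow> 'a \<Rightarrow> real ^ 'n::nontriv mod_ring) \<Rightarrow>
    (real \<Rightarrow> real) \<Rightarrow> real \<Rightarrow> real \<Rightarrow> real ^ 'n mod_ring \<Rightarrow> real ^ 'n mod_ring \<Rightarrow>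
    (real \<Rightarrow> 'a \<Rightarrow> real ^ 'n mod_ring) \<Rightarrow> (real \<Rightarrow> 'a \<Rightarrow> real ^ 'n mod_ring) \<Rightarrow> bool" where
  "agent_solution M F W U' \<beta> \<sigma> Q0 p0 Q p \<longleftrightarrow>
     adapted_continuous M F Q \<and> adapted_continuous M F p \<and>
     (\<forall>n. ito_differential M W (\<lambda>t \<omega>. Q t \<omega> $ n) (Q0 $ n)
            (\<lambda>t \<omega>. p t \<omega> $ (n + 1) - p t \<omega> $ n)
            (\<lambda>w. 0)) \<and>
     (\<forall>n. ito_differential M W (\<lambda>t \<omega>. p t \<omega> $ n) (p0 $ n)
            (\<lambda>t \<omega>. (U' (Q t \<omega> $ n) - U' (Q t \<omega> $ (n - 1))) +
                   \<beta> * (p t \<omega> $ (n + 1) - 2 * p t \<omega> $ n + p t \<omega> $ (n - 1)))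
            (\<lambda>w. \<sigma> * w $ n))"

definition port_hamiltonian_solution ::
  "'a measure \<Rightarrow> (real \<Rightarrow> 'a measure) \<Rightarrow> (real \<Rightarrow> 'a \<Rightarrow> real ^ 'm::finite) \<Rightarrow>
    real ^ 'd ^ 'd \<Rightarrow> real ^ 'd ^ 'd \<Rightarrow> real ^ 'm ^ 'd \<Rightarrow> (real ^ 'd::finite \<Rightarrow> real) \<Rightarrow>
    real ^ 'd \<Rightarrow> (real \<Rightarrow> 'a \<Rightarrow> real ^ 'd) \<Rightarrow> bool" where
  "port_hamiltonian_solution M F W J R G H z0 Z \<longleftrightarrow>
     adapted_continuous M F Z \<and>
     ito_differential M W Z z0 (\<lambda>t \<omega>. (J - R) *v grad H (Z t \<omega>)) (\<lambda>w. G *v w)"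

end

theory Submission
  imports Defs
begin

text \<open>
  An integrated differential of vectors holds iff it holds in every coordinate, so only the drift
  has to be compared. Multiplication by \<open>A\<close> is the forward difference on the cycle and by
  \<open>- A\<^sup>T\<close> the backward difference; hence \<open>- A\<^sup>T A\<close> is the discrete Laplacian, which is also why
  \<open>R\<close> is positive semi-definite: its quadratic form is \<open>\<beta> \<parallel>A p\<parallel>\<^sup>2\<close>.
\<close>

lemma stack_nth [simp]: "stack x y $ Inl k = x $ k" "stack x y $ Inr l = y $ l"
  by (simp_all add: stack_def)

lemma vec_eq_iff_sum:
  "x = y \<longleftrightarrow> (\<forall>k. x $ Inl k = y $ Inl k) \<and> (\<forall>l. x $ Inr l = y $ Inr l)"
  for x y :: "'b ^ ('k::finite + 'l::finite)"
  by (simp add: vec_eq_iff split_sum_all)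

text \<open>The block rules fire only on vectors of the form \<open>stack x y\<close>; this brings
  an arbitrary vector into that form.\<close>

lemma stack_cases:
  obtains x y where "v = stack x y"
proof
  show "v = stack (\<chi> k. v $ Inl k) (\<chi> l. v $ Inr l)"
    by (simp add: vec_eq_iff_sum)
qed

lemma sum_UNIV_Plus:
  "(\<Sum>i\<in>UNIV. f i) = (\<Sum>k\<in>UNIV. f (Inl k)) + (\<Sum>l\<in>UNIV. f (Inr l))"
  for f :: "'k::finite + 'l::finite \<Rightarrow> 'b::comm_monoid_add"
  by (simp add: sum.Plus flip: UNIV_Plus_UNIV)

lemma inner_stack: "stack x y \<bullet> stack x' y' = x \<bullet> x' + y \<bullet> y'"
  by (simp add: inner_vec_def sum_UNIV_Plus)

lemma block_matrix_nth [simp]: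
  "block_matrix B C D E $ Inl r $ Inl k = B $ r $ k"
  "block_matrix B C D E $ Inl r $ Inr l = C $ r $ l"
  "block_matrix B C D E $ Inr s $ Inl k = D $ s $ k"
  "block_matrix B C D E $ Inr s $ Inr l = E $ s $ l"
  by (simp_all add: block_matrix_def)

lemma transpose_block_matrix:
  "transpose (block_matrix B C D E) =
     block_matrix (transpose B) (transpose D) (transpose C) (transpose E)"
  by (simp add: vec_eq_iff_sum transpose_def)

lemma uminus_block_matrix: "- block_matrix B C D E = block_matrix (- B) (- C) (- D) (- E)"
  by (simp add: vec_eq_iff_sum)

lemma diff_block_matrix:
  "block_matrix B C D E - block_matrix B' C' D' E' =
     block_matrix (B - B') (C - C') (D - D') (E - E')"
  by (simp add: vec_eq_iff_sum)

lemma block_matrix_mult_vec: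
  "block_matrix B C D E *v stack x y = stack (B *v x + C *v y) (D *v x + E *v y)"
  by (simp add: vec_eq_iff_sum matrix_vector_mult_def sum_UNIV_Plus)

lemma stack_mult_vec: "stack B C *v x = stack (B *v x) (C *v x)"
  by (simp add: vec_eq_iff_sum matrix_vector_mult_def)

lemma transpose_uminus: "transpose (- A) = - transpose A"
  by (simp add: vec_eq_iff transpose_def)

lemma transpose_zero: "transpose 0 = 0"
  by (simp add: vec_eq_iff transpose_def)

lemma uminus_matrix_mult_vec: "(- A) *v x = - (A *v x)" for A :: "real ^ 'n ^ 'm"
  by (simp add: vec_eq_iff matrix_vector_mult_def sum_negf)

lemma circ_mat_mult_vec: "(circ_mat *v x) $ n = x $ (n + 1) - x $ n"
proof -
  \<comment> \<open>The nested conditional of row \<open>n\<close> may be split into two independent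
    indicators because \<open>n + 1\<close> differs from \<open>n\<close>: the index ring is
    nontrivial, so \<open>1\<close> is not \<open>0\<close>.\<close>
  have "(circ_mat *v x) $ n =
    (\<Sum>j\<in>UNIV. (if j = n + 1 then x $ j else 0) - (if j = n then x $ j else 0))"
    unfolding circ_mat_def matrix_vector_mult_def by (auto intro!: sum.cong)
  then show ?thesis
    by (simp add: sum_subtractf)
qed

lemma transpose_circ_mat_mult_vec: "(transpose circ_mat *v x) $ n = x $ (n - 1) - x $ n"
proof -
  \<comment> \<open>Column \<open>n\<close> of \<open>circ_mat\<close> has its entry 1 in the row
    \<open>j\<close> with \<open>n = j + 1\<close>, that is \<open>j = n - 1\<close>.\<close>
  have "(transpose circ_mat *v x) $ n =
    (\<Sum>j\<in>UNIV. (if j = n - 1 then x $ j else 0) - (if j = n then x $ j else 0))"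
    unfolding circ_mat_def matrix_vector_mult_def transpose_def
    by (auto intro!: sum.cong)
  then show ?thesis
    by (simp add: sum_subtractf)
qed

lemma adapted_continuous_vec_iff:
  fixes X :: "real \<Rightarrow> 'a \<Rightarrow> real ^ 'd"
  shows "adapted_continuous M F X \<longleftrightarrow> (\<forall>i. adapted_continuous M F (\<lambda>t \<omega>. X t \<omega> $ i))"
proof -
  have "X t \<in> borel_measurable N \<longleftrightarrow> (\<forall>i. (\<lambda>\<omega>. X t \<omega> $ i) \<in> borel_measurable N)" for t N
    by (subst borel_measurable_euclidean_space) (simp add: Basis_vec_def inner_axis)
  moreover have "continuous_on S (\<lambda>t. X t \<omega>) \<longleftrightarrow> (\<forall>i. continuous_on S (\<lambda>t. X t \<omega> $ i))" for S \<omega>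
    by (subst continuous_on_componentwise) (simp add: Basis_vec_def inner_axis)
  \<comment> \<open>The index set is finite, so the almost sure statements for all coordinates hold
    on one common event.\<close>
  ultimately show ?thesis
    by (auto simp: adapted_continuous_def eventually_all_finite)
qed

lemma ito_differential_vec_iff:
  fixes X :: "real \<Rightarrow> 'a \<Rightarrow> real ^ 'd"
  shows "ito_differential M W X x0 b g \<longleftrightarrow>
    (\<forall>i. ito_differential M W (\<lambda>t \<omega>. X t \<omega> $ i) (x0 $ i) (\<lambda>t \<omega>. b t \<omega> $ i) (\<lambda>w. g w $ i))"
proof -
  have abs_int: "(\<lambda>s. b s \<omega>) absolutely_integrable_on S \<longleftrightarrow>
      (\<forall>i. (\<lambda>s. b s \<omega> $ i) absolutely_integrable_on S)" for S \<omega>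
    by (subst absolutely_integrable_componentwise_iff) (simp add: Basis_vec_def inner_axis)
  have "(\<lambda>s. b s \<omega>) absolutely_integrable_on {0..t} \<and>
        X t \<omega> = x0 + integral {0..t} (\<lambda>s. b s \<omega>) + g (W t \<omega> - W 0 \<omega>) \<longleftrightarrow>
      (\<forall>i. (\<lambda>s. b s \<omega> $ i) absolutely_integrable_on {0..t} \<and>
        X t \<omega> $ i = x0 $ i + integral {0..t} (\<lambda>s. b s \<omega> $ i) + g (W t \<omega> - W 0 \<omega>) $ i)" for t \<omega>
  \<comment> \<open>Taking a coordinate out of the integral requires integrability. Without it both
    sides are false, since some coordinate of the drift then fails to be integrable.\<close>
  proof (cases "(\<lambda>s. b s \<omega>) absolutely_integrable_on {0..t}")
    case True
    then have "integral {0..t} (\<lambda>s. b s \<omega> $ i) = integral {0..t} (\<lambda>s. b s \<omega>) $ i" for i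
      by (intro integral_component_eq_cart) (auto dest: set_lebesgue_integral_eq_integral)
    with True show ?thesis
      by (auto simp: vec_eq_iff abs_int)
  next
    case False
    then show ?thesis
      by (auto simp: abs_int)
  qed
  \<comment> \<open>The coordinate quantifier is moved in front of the one over the uncountably many
    times; being finite, it can then leave the \<open>AE\<close>, while time stays inside.\<close>
  then have "ito_differential M W X x0 b g \<longleftrightarrow> (AE \<omega> in M. \<forall>i. \<forall>t\<ge>0.
      (\<lambda>s. b s \<omega> $ i) absolutely_integrable_on {0..t} \<and>
      X t \<omega> $ i = x0 $ i + integral {0..t} (\<lambda>s. b s \<omega> $ i) + g (W t \<omega> - W 0 \<omega>) $ i)"
    by (simp only: ito_differential_def all_comm[of "\<lambda>i t. 0 \<le> t \<longrightarrow> _ i t"] flip: all_simps(6))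
  then show ?thesis
    using eventually_ball_finite_distrib[of "UNIV :: 'd set"] by (simp add: ito_differential_def)
qed

text \<open>\<open>grad\<close> is a definite description, so uniqueness is required: the derivative
  is a unique linear functional, and an inner product functional determines its vector.\<close>

lemma grad_eqI:
  assumes "GDERIV f x :> d"
  shows "grad f x = d"
  unfolding grad_def
proof (rule the_equality)
  fix d' assume "GDERIV f x :> d'"
  with assms have "(\<lambda>h. h \<bullet> d') = (\<lambda>h. h \<bullet> d)"
    unfolding gderiv_def by (rule has_derivative_unique[rotated])
  then show "d' = d"
    by (metis inner_commute vector_eq_ldot)
qed (rule assms)

lemma grad_hamiltonian:
  assumes "\<And>x. (U has_real_derivative U' x) (at x)"
  shows "grad (hamiltonian U) (stack x y) = stack (\<chi> n. U' (x $ n)) y"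
proof (rule grad_eqI)
  \<comment> \<open>As a sum of products the kinetic term is differentiated by the product rule,
    even at zero momentum, where the norm itself is not differentiable.\<close>
  have norm_sq: "(norm (\<chi> n. z $ Inr n))\<^sup>2 = (\<Sum>n\<in>UNIV. z $ Inr n * z $ Inr n)"
    for z :: "real ^ ('a mod_ring + 'a mod_ring)"
    by (simp add: power2_norm_eq_inner inner_vec_def)
  have nth: "((\<lambda>z. z $ i) has_derivative (\<lambda>h. h $ i)) (at (stack x y))" for i
    by (rule bounded_linear_imp_has_derivative) (rule bounded_linear_vec_nth)
  have U: "((\<lambda>z :: real ^ ('a mod_ring + 'a mod_ring). U (z $ Inl n)) has_derivative
      (\<lambda>h. h $ Inl n * U' (x $ n))) (at (stack x y))" for n
  proof -
    have "(U has_derivative (\<lambda>h. h * U' (x $ n))) (at (stack x y $ Inl n))"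
      using assms[of "x $ n"] by (simp add: has_field_derivative_def mult_commute_abs)
    with nth show ?thesis
      by (rule has_derivative_compose)
  qed
  show "GDERIV (hamiltonian U) (stack x y) :> stack (\<chi> n. U' (x $ n)) y"
    unfolding gderiv_def hamiltonian_def norm_sq
    by (rule derivative_eq_intros nth U refl)+
      (auto simp: fun_eq_iff inner_vec_def sum_UNIV_Plus sum_distrib_left field_simps)
qed

text \<open>Transposition swaps the off-diagonal blocks and transposes each, and these are negative
  transposes of one another.\<close>

lemma transpose_J_mat: "transpose J_mat = - J_mat"
  by (simp add: J_mat_def transpose_block_matrix uminus_block_matrix transpose_uminus transpose_zero)

lemma transpose_R_mat: "transpose (R_mat \<beta>) = R_mat \<beta>"
  by (simp add: R_mat_def transpose_block_matrix transpose_zero transpose_scalar matrix_transpose_mul)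

lemma R_mat_psd:
  assumes "\<beta> \<ge> 0"
  shows "0 \<le> v \<bullet> (R_mat \<beta> *v v)"
proof -
  obtain x y where v: "v = stack x y"
    by (rule stack_cases)
  have "v \<bullet> (R_mat \<beta> *v v) = \<beta> * (y \<bullet> (transpose circ_mat *v (circ_mat *v y)))"
    by (simp add: v R_mat_def block_matrix_mult_vec inner_stack
        scaleR_matrix_vector_assoc[symmetric] matrix_vector_mul_assoc del: transpose_matrix_vector)
  \<comment> \<open>The rule \<open>transpose_matrix_vector\<close>, held back above, now applies as
    a simp rule: the transpose becomes a multiplication from the left, which
    \<open>dot_lmul_matrix\<close> moves to the other factor.\<close>
  also have "\<dots> = \<beta> * ((circ_mat *v y) \<bullet> (circ_mat *v y))"
    by (simp add: dot_lmul_matrix inner_commute[of y])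
  finally show ?thesis
    using assms by simp
qed

text \<open>The gradient at \<open>stack x y\<close> consists of the forces
  \<open>U' (x $ n)\<close> and of \<open>y\<close>. The upper block yields the forward difference
  of \<open>y\<close>; the lower one applies the negative transpose of \<open>circ_mat\<close> to
  the forces and to \<beta> times the forward difference of \<open>y\<close>.\<close>

lemma port_hamiltonian_drift:
  assumes "\<And>x. (U has_real_derivative U' x) (at x)"
  shows "(J_mat - R_mat \<beta>) *v grad (hamiltonian U) (stack x y) =
    stack (\<chi> n. y $ (n + 1) - y $ n)
      (\<chi> n. (U' (x $ n) - U' (x $ (n - 1))) + \<beta> * (y $ (n + 1) - 2 * y $ n + y $ (n - 1)))"
  unfolding grad_hamiltonian[OF assms] J_mat_def R_mat_def diff_block_matrix block_matrix_mult_vec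
  by (simp add: vec_eq_iff_sum circ_mat_mult_vec transpose_circ_mat_mult_vec
      uminus_matrix_mult_vec matrix_vector_mul_assoc[symmetric]
      scaleR_matrix_vector_assoc[symmetric] algebra_simps del: transpose_matrix_vector)

theorem proposition2p1:
  fixes M :: "'a measure" and F :: "real \<Rightarrow> 'a measure"
    and W :: "real \<Rightarrow> 'a \<Rightarrow> real ^ 'n::nontriv mod_ring"
    and U U' :: "real \<Rightarrow> real" and \<beta> \<sigma> L :: real
    and Q0 p0 :: "real ^ 'n mod_ring"
    and Q p :: "real \<Rightarrow> 'a \<Rightarrow> real ^ 'n mod_ring"
  assumes "CARD('n) \<ge> 3"
    and "\<beta> > 0"
    and "\<And>x. U x \<ge> 0"
    and "\<And>x. (U has_real_derivative U' x) (at x)"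
    and "continuous_on UNIV U'"
    and "convex_on UNIV U"
    and "filtered_prob_space M F"
    and "standard_brownian_motion M F W"
    and "\<And>n. Q0 $ n \<ge> 0"
    and "(\<Sum>n\<in>UNIV. Q0 $ n) = L" and "L > 0"
  shows "(agent_solution M F W U' \<beta> \<sigma> Q0 p0 Q p \<longleftrightarrow>
            port_hamiltonian_solution M F W J_mat (R_mat \<beta>) (G_mat \<sigma>) (hamiltonian U)
              (stack Q0 p0) (\<lambda>t \<omega>. stack (Q t \<omega>) (p t \<omega>))) \<and>
         transpose (J_mat :: real ^ ('n mod_ring + 'n mod_ring) ^ ('n mod_ring + 'n mod_ring)) =
           - J_mat \<and>
         transpose (R_mat \<beta> :: real ^ ('n mod_ring + 'n mod_ring) ^ ('n mod_ring + 'n mod_ring)) =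
           R_mat \<beta> \<and>
         (\<forall>v :: real ^ ('n mod_ring + 'n mod_ring). 0 \<le> v \<bullet> (R_mat \<beta> *v v))"
proof (intro conjI allI)
  have drift: "(\<lambda>t \<omega>. (J_mat - R_mat \<beta>) *v grad (hamiltonian U) (stack (Q t \<omega>) (p t \<omega>))) =
      (\<lambda>t \<omega>. stack (\<chi> n. p t \<omega> $ (n + 1) - p t \<omega> $ n)
        (\<chi> n. (U' (Q t \<omega> $ n) - U' (Q t \<omega> $ (n - 1))) +
          \<beta> * (p t \<omega> $ (n + 1) - 2 * p t \<omega> $ n + p t \<omega> $ (n - 1))))"
    by (simp only: port_hamiltonian_drift[OF assms(4)])
  \<comment> \<open>The zero block accounts for the absence of noise in the distance
    equations.\<close>
  have noise: "(\<lambda>w :: real ^ 'n mod_ring. G_mat \<sigma> *v w) = (\<lambda>w. stack 0 (\<sigma> *\<^sub>R w))"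
    by (simp add: G_mat_def stack_mult_vec scaleR_matrix_vector_assoc[symmetric])
  show "agent_solution M F W U' \<beta> \<sigma> Q0 p0 Q p \<longleftrightarrow>
      port_hamiltonian_solution M F W J_mat (R_mat \<beta>) (G_mat \<sigma>) (hamiltonian U)
        (stack Q0 p0) (\<lambda>t \<omega>. stack (Q t \<omega>) (p t \<omega>))"
    \<comment> \<open>Both sides become the same scalar conditions: \<open>split_sum_all\<close>
      separates the coordinates of the stacked process into distances and velocities.\<close>
    unfolding agent_solution_def port_hamiltonian_solution_def drift noise
      adapted_continuous_vec_iff ito_differential_vec_iff split_sum_all
    by simp
  show "transpose J_mat = - (J_mat :: real ^ ('n mod_ring + 'n mod_ring) ^ ('n mod_ring + 'n mod_ring))"
    by (rule transpose_J_mat)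
  show "transpose (R_mat \<beta>) = (R_mat \<beta> :: real ^ ('n mod_ring + 'n mod_ring) ^ ('n mod_ring + 'n mod_ring))"
    by (rule transpose_R_mat)
  show "0 \<le> v \<bullet> (R_mat \<beta> *v v)" for v :: "real ^ ('n mod_ring + 'n mod_ring)"
    using assms(2) by (intro R_mat_psd) simp
qed

end
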